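(* Let $Q_8=\langle i,j,k\mid ijk^{-1},\, jki^{-1},\, kij^{-1},\, i^4\rangle$ be the quaternion group. Then for every finite symmetric generating set $A$ of $Q_8$, the geodesic language $\mathsf{Geo}(Q_8,A)$ is piecewise excluding.
   Context: A generating set $A$ of a group $G$ is symmetric if it is inverse-closed: $A$ is a subset of $G$ generating $G$ and $a\in A$ implies $a^{-1}\in A$ (the identity element is allowed to belong to $A$). $A^*$ denotes the set of all finite words over the alphabet $A$, including the empty word. A word $w\in A^*$ is geodesic if it labels a path of minimal length between two vertices of the Cayley graph of $G$ over $A$; equivalently, no strictly shorter word over $A$ represents the same element of $G$ as $w$. The geodesic language $\mathsf{Geo}(G,A)\subseteq A^*$ is the set of all geodesic words. A word $a_1a_2\cdots a_n$ ($a_i\in A$) is a piecewise subword of $w\in A^*$ if $w=w_0a_1w_1a_2\cdots a_nw_n$ for some $w_i\in A^*$ (i.e. it is a not necessarily contiguous subsequence of $w$). A language $L\subseteq A^*$ is piecewise excluding if there is a finite set $F\subset A^*$ such that, for all $w\in A^*$, $w\in L$ if and only if $w$ contains no piecewise subword in $F$. *)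

theory Defs
  imports "HOL-Algebra.Generated_Groups" "HOL-Library.Sublist"
begin

section \<open>Groups given by generators and relators\<close>

text \<open>
  A word over the generators and their formal inverses is a list of pairs: \<open>(x, True)\<close> stands for
  the generator \<open>x\<close> and \<open>(x, False)\<close> for its formal inverse.  The type \<open>'x\<close> as a whole is the set of
  generators.
\<close>

type_synonym 'x gword = "('x \<times> bool) list"

inductive pres_eq :: "'x gword set \<Rightarrow> 'x gword \<Rightarrow> 'x gword \<Rightarrow> bool" for R where
  pres_refl: "pres_eq R u u"
| pres_sym: "pres_eq R u v \<Longrightarrow> pres_eq R v u"
| pres_trans: "pres_eq R u v \<Longrightarrow> pres_eq R v w \<Longrightarrow> pres_eq R u w"
| pres_append: "pres_eq R u u' \<Longrightarrow> pres_eq R v v' \<Longrightarrow> pres_eq R (u @ v) (u' @ v')"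
| pres_cancel: "pres_eq R [(x, b), (x, \<not> b)] []"
| pres_relator: "r \<in> R \<Longrightarrow> pres_eq R r []"

definition pres_rel :: "'x gword set \<Rightarrow> 'x gword rel" where
  "pres_rel R = {(u, v). pres_eq R u v}"

definition presented_group :: "'x gword set \<Rightarrow> 'x gword set monoid" where
  "presented_group R =
    \<lparr>carrier = UNIV // pres_rel R,
     monoid.mult = (\<lambda>X Y. \<Union>u\<in>X. \<Union>v\<in>Y. pres_rel R `` {u @ v}),
     one = pres_rel R `` {[]}\<rparr>"

lemma equiv_pres_rel: "equiv UNIV (pres_rel R)"
  by (rule equivI)
    (auto simp: pres_rel_def intro!: refl_onI symI transI intro: pres_eq.intros)

lemma presented_group_mult:
  "pres_rel R `` {u} \<otimes>\<^bsub>presented_group R\<^esub> pres_rel R `` {v} = pres_rel R `` {u @ v}"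
proof -
  have "congruent2 (pres_rel R) (pres_rel R) (\<lambda>u v. pres_rel R `` {u @ v})"
  proof (rule congruent2I')
    fix u u' v v' assume "(u, u') \<in> pres_rel R" "(v, v') \<in> pres_rel R"
    then have "(u @ v, u' @ v') \<in> pres_rel R"
      by (simp add: pres_rel_def pres_append)
    then show "pres_rel R `` {u @ v} = pres_rel R `` {u' @ v'}"
      by (rule equiv_class_eq[OF equiv_pres_rel])
  qed
  then show ?thesis
    using UN_equiv_class2[OF equiv_pres_rel equiv_pres_rel]
    by (simp add: presented_group_def)
qed

lemma pres_eq_inverse: "pres_eq R (rev (map (map_prod id Not) u) @ u) []"
proof (induction u)
  case Nil
  show ?case by (simp add: pres_refl)
next
  case (Cons a u)
  obtain x b where a: "a = (x, b)" by fastforce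
  have "pres_eq R [(x, \<not> b), (x, b)] []"
    using pres_cancel[of R x "\<not> b"] by simp
  then have "pres_eq R (rev (map (map_prod id Not) u) @ [(x, \<not> b), (x, b)] @ u)
      (rev (map (map_prod id Not) u) @ [] @ u)"
    by (intro pres_append pres_refl)
  then have "pres_eq R (rev (map (map_prod id Not) u) @ [(x, \<not> b), (x, b)] @ u) []"
    using Cons.IH unfolding append_Nil by (rule pres_trans)
  then show ?case
    by (simp add: a id_def)
qed

lemma group_presented_group: "group (presented_group R)"
proof (rule groupI)
  have carr: "X \<in> carrier (presented_group R) \<longleftrightarrow> (\<exists>u. X = pres_rel R `` {u})" for X
    by (auto simp: presented_group_def quotient_def)
  have one: "\<one>\<^bsub>presented_group R\<^esub> = pres_rel R `` {[]}"
    by (simp add: presented_group_def)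
  show "\<one>\<^bsub>presented_group R\<^esub> \<in> carrier (presented_group R)"
    using carr one by blast
  fix X assume "X \<in> carrier (presented_group R)"
  then obtain u where u: "X = pres_rel R `` {u}" using carr by blast
  show "\<one>\<^bsub>presented_group R\<^esub> \<otimes>\<^bsub>presented_group R\<^esub> X = X"
    by (simp add: u one presented_group_mult)
  have "pres_rel R `` {rev (map (map_prod id Not) u) @ u} = pres_rel R `` {[]}"
    using pres_eq_inverse by (intro equiv_class_eq[OF equiv_pres_rel]) (auto simp: pres_rel_def)
  then show "\<exists>Y\<in>carrier (presented_group R).
      Y \<otimes>\<^bsub>presented_group R\<^esub> X = \<one>\<^bsub>presented_group R\<^esub>"
    using carr one presented_group_mult u by metis
  fix Y assume "Y \<in> carrier (presented_group R)"
  then obtain v where v: "Y = pres_rel R `` {v}" using carr by blast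
  show "X \<otimes>\<^bsub>presented_group R\<^esub> Y \<in> carrier (presented_group R)"
    by (auto simp: u v presented_group_mult carr)
  fix Z assume "Z \<in> carrier (presented_group R)"
  then obtain w where w: "Z = pres_rel R `` {w}" using carr by blast
  show "X \<otimes>\<^bsub>presented_group R\<^esub> Y \<otimes>\<^bsub>presented_group R\<^esub> Z =
      X \<otimes>\<^bsub>presented_group R\<^esub> (Y \<otimes>\<^bsub>presented_group R\<^esub> Z)"
    by (simp add: u v w presented_group_mult)
qed


section \<open>The quaternion group\<close>

datatype q8_gen = Gi | Gj | Gk

definition q8_relators :: "q8_gen gword set" where
  "q8_relators =
    {[(Gi, True), (Gj, True), (Gk, False)],
     [(Gj, True), (Gk, True), (Gi, False)],
     [(Gk, True), (Gi, True), (Gj, False)],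
     [(Gi, True), (Gi, True), (Gi, True), (Gi, True)]}"

definition Q8 :: "q8_gen gword set monoid" where
  "Q8 = presented_group q8_relators"

lemma group_Q8: "group Q8"
  unfolding Q8_def by (rule group_presented_group)


section \<open>Geodesic words and piecewise excluding languages\<close>

definition symmetric_generating_set :: "('a, 'b) monoid_scheme \<Rightarrow> 'a set \<Rightarrow> bool" where
  "symmetric_generating_set G A \<longleftrightarrow>
    A \<subseteq> carrier G \<and> generate G A = carrier G \<and> (\<forall>a\<in>A. inv\<^bsub>G\<^esub> a \<in> A)"

definition word_value :: "('a, 'b) monoid_scheme \<Rightarrow> 'a list \<Rightarrow> 'a" where
  "word_value G w = foldr (\<lambda>a x. a \<otimes>\<^bsub>G\<^esub> x) w \<one>\<^bsub>G\<^esub>"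

definition Geo :: "('a, 'b) monoid_scheme \<Rightarrow> 'a set \<Rightarrow> 'a list set" where
  "Geo G A =
    {w \<in> lists A. \<not> (\<exists>v\<in>lists A. length v < length w \<and> word_value G v = word_value G w)}"

text \<open>
  \<open>subseq u w\<close> from \<open>HOL-Library.Sublist\<close> says that \<open>u\<close> is a not necessarily contiguous subsequence
  of \<open>w\<close>, that is, a piecewise subword.
\<close>

definition piecewise_excluding :: "'a set \<Rightarrow> 'a list set \<Rightarrow> bool" where
  "piecewise_excluding A L \<longleftrightarrow>
    L \<subseteq> lists A \<and>
    (\<exists>F. finite F \<and> F \<subseteq> lists A \<and>
      (\<forall>w\<in>lists A. w \<in> L \<longleftrightarrow> \<not> (\<exists>u\<in>F. subseq u w)))"

end

theory Submission
  imports Defs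
begin

text \<open>
  Factors of geodesic words are geodesic, and a piecewise subword of a word of length at most 2 is
  a factor.  So it suffices that no word of length 3 is geodesic: the language is then defined by
  excluding the non-geodesic words of length at most 3.  Up to the central sign \<open>z = -1\<close>, a product
  of three non-central elements \<open>a, b, c\<close> of the quaternion group is one of \<open>1, a, b, c\<close>, because
  this holds for the three non-zero elements of the Klein four-group.  As \<open>-a = a\<^sup>-\<^sup>1\<close> and
  \<open>-1 = a\<^sup>2\<close>, such a product has length at most 2 over any symmetric set containing \<open>a, b, c\<close>.
\<close>

section \<open>Geodesic words in an arbitrary group\<close>

context group
begin

lemma word_value_Nil [simp]: "word_value G [] = \<one>"
  by (simp add: word_value_def)

lemma word_value_Cons [simp]: "word_value G (a # w) = a \<otimes> word_value G w"
  by (simp add: word_value_def)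

lemma word_value_closed: "set w \<subseteq> carrier G \<Longrightarrow> word_value G w \<in> carrier G"
  by (induction w) auto

lemma word_value_append:
  assumes "set u \<subseteq> carrier G" "set v \<subseteq> carrier G"
  shows "word_value G (u @ v) = word_value G u \<otimes> word_value G v"
  using assms by (induction u) (auto simp: word_value_closed m_assoc)

text \<open>Replacing a factor by a shorter word of the same value would shorten the whole word
  without changing its value.\<close>

lemma Geo_sublist:
  assumes "A \<subseteq> carrier G" "w \<in> Geo G A" "sublist u w"
  shows "u \<in> Geo G A"
proof -
  obtain p s where w: "w = p @ u @ s"
    using assms(3) by (auto simp: sublist_def)
  have lists: "p \<in> lists A" "u \<in> lists A" "s \<in> lists A"
    using assms(2) by (auto simp: Geo_def w)
  have False if v: "v \<in> lists A" "length v < length u" "word_value G v = word_value G u" for v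
  proof -
    have sub: "set p \<subseteq> carrier G" "set u \<subseteq> carrier G" "set s \<subseteq> carrier G" "set v \<subseteq> carrier G"
      using lists v(1) assms(1) by (auto simp: in_lists_conv_set)
    then have "word_value G (p @ v @ s) = word_value G w"
      using v(3) by (simp add: w word_value_append)
    moreover have "p @ v @ s \<in> lists A" "length (p @ v @ s) < length w"
      using lists v by (auto simp: w)
    ultimately show False
      using assms(2) unfolding Geo_def by blast
  qed
  then show ?thesis
    using lists unfolding Geo_def by blast
qed

lemma piecewise_excluding_Geo:
  assumes "A \<subseteq> carrier G" "finite A"
    and short: "\<And>a b c. \<lbrakk>a \<in> A; b \<in> A; c \<in> A\<rbrakk> \<Longrightarrow>
      \<exists>v\<in>lists A. length v \<le> 2 \<and> word_value G v = a \<otimes> b \<otimes> c"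
  shows "piecewise_excluding A (Geo G A)"
proof -
  \<comment> \<open>The bound 3 makes \<open>F\<close> finite and still lets it contain every word
    of length 3 over \<open>A\<close>, since none of these is geodesic.\<close>
  define F where "F = {u \<in> lists A. length u \<le> 3 \<and> u \<notin> Geo G A}"
  have not_Geo3: "u \<notin> Geo G A" if len: "length u = 3" for u
  proof
    assume "u \<in> Geo G A"
    moreover obtain a b c where u: "u = [a, b, c]"
      using len by (auto simp: eval_nat_numeral length_Suc_conv)
    ultimately have "a \<in> A" "b \<in> A" "c \<in> A"
      by (auto simp: Geo_def)
    moreover from this have "word_value G u = a \<otimes> b \<otimes> c"
      using assms(1) by (auto simp: u m_assoc subset_iff)
    ultimately obtain v where "v \<in> lists A" "length v < length u" "word_value G v = word_value G u"
      using short[of a b c] len by fastforce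
    with \<open>u \<in> Geo G A\<close> show False
      unfolding Geo_def by blast
  qed
  have take3: "take 3 w \<notin> Geo G A" if "length w \<ge> 3" for w
    using that by (intro not_Geo3) simp
  have "w \<in> Geo G A \<longleftrightarrow> \<not> (\<exists>u\<in>F. subseq u w)" if w: "w \<in> lists A" for w
  proof
    assume geo: "w \<in> Geo G A"
    then have "\<not> length w \<ge> 3"
      using take3 Geo_sublist[OF assms(1)] sublist_take by blast
    then have len: "length w \<le> 2"
      by simp
    have "u \<in> Geo G A" if "subseq u w" for u
    proof -
      have "length u \<le> length w"
        using that by (rule list_emb_length)
      \<comment> \<open>A piecewise subword of a word of length at most 2 is the whole word, empty
        or a single letter, so in each case a factor.\<close>
      then consider "length u = length w" | "length u = 0" | "length u = 1"
        using len by linarith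
      then have "sublist u w"
      proof cases
        case 1
        then show ?thesis
          using that subseq_same_length by blast
      next
        case 3
        then obtain a where "u = [a]"
          by (auto simp: length_Suc_conv)
        then show ?thesis
          using that by (metis append_Cons append_Nil split_list sublist_def subseq_singleton_left)
      qed simp
      then show ?thesis
        by (rule Geo_sublist[OF assms(1) geo])
    qed
    then show "\<not> (\<exists>u\<in>F. subseq u w)"
      by (auto simp: F_def)
  next
    assume none: "\<not> (\<exists>u\<in>F. subseq u w)"
    show "w \<in> Geo G A"
    proof (rule ccontr)
      assume "w \<notin> Geo G A"
      \<comment> \<open>If \<open>w\<close> has fewer than 3 letters, \<open>take 3 w\<close> is
        \<open>w\<close> itself; otherwise it is a word of length 3.\<close>
      then have "take 3 w \<notin> Geo G A"
        using take3[of w] by (cases "length w \<ge> 3") auto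
      then have "take 3 w \<in> F"
        using w by (auto simp: F_def dest: in_set_takeD)
      moreover have "subseq (take 3 w) w"
        by (intro prefix_imp_subseq take_is_prefix)
      ultimately show False
        using none by blast
    qed
  qed
  moreover have "finite F"
    by (rule finite_subset[OF _ finite_lists_length_le[OF assms(2), of 3]])
      (auto simp: F_def in_lists_conv_set)
  ultimately show ?thesis
    unfolding piecewise_excluding_def by (intro conjI exI[of _ F]) (auto simp: F_def Geo_def)
qed

end

section \<open>Arithmetic up to sign, derived from the quaternion relations\<close>

locale quaternion_relations = group G for G (structure) +
  fixes i j k
  assumes ijk_closed [simp]: "i \<in> carrier G" "j \<in> carrier G" "k \<in> carrier G"
    and ij: "i \<otimes> j = k" and jk: "j \<otimes> k = i" and ki: "k \<otimes> i = j"
    and i4: "(i \<otimes> i) \<otimes> (i \<otimes> i) = \<one>"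
    and generated: "generate G {i, j, k} = carrier G"
begin

definition z where "z = i \<otimes> i"

text \<open>Congruence modulo the central subgroup {1, z}, where \<open>z\<close> plays the role of
  -1. In particular \<open>\<one> \<approx> x\<close> says that \<open>x\<close> is 1 or
  \<open>z\<close>.\<close>

definition upto_sign (infix \<open>\<approx>\<close> 50) where "x \<approx> y \<longleftrightarrow> y = x \<or> y = z \<otimes> x"

lemma z_closed [simp]: "z \<in> carrier G"
  by (simp add: z_def)

lemma zz: "z \<otimes> z = \<one>"
  using i4 by (simp add: z_def)

lemma ii: "i \<otimes> i = z"
  by (simp add: z_def)

text \<open>Regroup: j j = j (k i) = (j k) i = i i. The same cyclic shift gives
  \<open>kk\<close>.\<close>

lemma jj: "j \<otimes> j = z"
  by (metis ijk_closed ii jk ki m_assoc)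

lemma kk: "k \<otimes> k = z"
  by (metis ijk_closed jj ij ki m_assoc)

lemma z_z_cancel [simp]: "x \<in> carrier G \<Longrightarrow> z \<otimes> (z \<otimes> x) = x"
  by (metis l_one m_assoc z_closed zz)

text \<open>Each generator commutes with \<open>z\<close> because \<open>z\<close> is its square;
  commuting with \<open>z\<close> passes to inverses and products.\<close>

lemma z_central:
  assumes "x \<in> carrier G"
  shows "x \<otimes> z = z \<otimes> x"
proof -
  have gens: "y \<otimes> z = z \<otimes> y" if "y \<in> {i, j, k}" for y
    using that by (metis ijk_closed ii jj kk m_assoc insertE emptyE)
  have "x \<in> generate G {i, j, k}"
    using assms generated by simp
  then show ?thesis
  proof induction
    case (inv h)
    then have "h \<in> carrier G" by auto
    then show ?case
      using gens[OF inv] by (metis inv_closed inv_solve_left inv_solve_right m_closed m_assoc z_closed)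
  next
    case (eng g h)
    then have "g \<in> carrier G" "h \<in> carrier G"
      using generated by auto
    then show ?case
      using eng.IH by (metis m_assoc z_closed)
  qed (use gens in auto)
qed

text \<open>Expand the second factor: j i = j (j k) = z k. Likewise for \<open>kj\<close> and
  \<open>ik\<close>.\<close>

lemma ji: "j \<otimes> i = z \<otimes> k"
  by (metis ijk_closed jj jk m_assoc)

lemma kj: "k \<otimes> j = z \<otimes> i"
  by (metis ijk_closed kk ki m_assoc)

lemma ik: "i \<otimes> k = z \<otimes> j"
  by (metis ijk_closed ii ij m_assoc)

lemma upto_sign_mult:
  assumes "x \<approx> x'" "y \<approx> y'" "x \<in> carrier G" "y \<in> carrier G"
  shows "x \<otimes> y \<approx> x' \<otimes> y'"
proof -
  have "x \<otimes> (z \<otimes> y) = z \<otimes> (x \<otimes> y)"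
    using assms(3,4) by (metis m_assoc z_central z_closed)
  then show ?thesis
    using assms by (auto simp: upto_sign_def m_assoc)
qed

lemma upto_sign_refl: "x \<approx> x"
  by (simp add: upto_sign_def)

lemma upto_sign_sym: "x \<approx> y \<Longrightarrow> x \<in> carrier G \<Longrightarrow> y \<approx> x"
  by (auto simp: upto_sign_def)

lemma upto_sign_trans: "x \<approx> y \<Longrightarrow> y \<approx> w \<Longrightarrow> x \<in> carrier G \<Longrightarrow> x \<approx> w"
  by (auto simp: upto_sign_def)

text \<open>Modulo sign, the products of generators follow the table of the Klein
  four-group.\<close>

lemma klein_table:
  "i \<otimes> i \<approx> \<one>" "j \<otimes> j \<approx> \<one>" "k \<otimes> k \<approx> \<one>" "i \<otimes> j \<approx> k" "j \<otimes> i \<approx> k"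
  "j \<otimes> k \<approx> i" "k \<otimes> j \<approx> i" "k \<otimes> i \<approx> j" "i \<otimes> k \<approx> j"
  by (auto simp: upto_sign_def ii jj kk ij jk ki ji kj ik zz)

lemma klein_table_full:
  assumes "r \<in> {\<one>, i, j, k}" "s \<in> {\<one>, i, j, k}"
  shows "\<exists>t\<in>{\<one>, i, j, k}. r \<otimes> s \<approx> t"
  using assms klein_table upto_sign_refl by auto

lemma upto_sign_representative:
  assumes "x \<in> carrier G"
  shows "\<exists>r\<in>{\<one>, i, j, k}. x \<approx> r"
proof -
  have "x \<in> generate G {i, j, k}"
    using assms generated by simp
  then show ?thesis
  proof induction
    case (inv h)
    then have h: "h \<in> carrier G" "h \<otimes> h = z"
      using ii jj kk by auto
    \<comment> \<open>Indeed (z h) h = z z = 1.\<close>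
    then have "inv h = z \<otimes> h"
      by (intro inv_equality) (auto simp: m_assoc zz)
    then have "inv h \<approx> h"
      using h(1) by (simp add: upto_sign_def)
    then show ?case
      using inv by auto
  next
    case (eng g h)
    then obtain r s where rs: "r \<in> {\<one>, i, j, k}" "s \<in> {\<one>, i, j, k}" "g \<approx> r" "h \<approx> s"
      by blast
    have carr: "g \<in> carrier G" "h \<in> carrier G"
      using eng generated by auto
    obtain t where "t \<in> {\<one>, i, j, k}" "r \<otimes> s \<approx> t"
      using klein_table_full rs by blast
    then show ?case
      using upto_sign_mult[OF rs(3,4) carr] upto_sign_trans carr by (metis m_closed)
  qed (use upto_sign_refl in auto)
qed

lemma noncentral_cases:
  assumes "x \<in> carrier G" "\<not> \<one> \<approx> x"
  obtains r where "r \<in> {i, j, k}" "r \<approx> x" "x \<approx> r"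
  using upto_sign_representative[OF assms(1)] assms upto_sign_sym by (metis insert_iff)

text \<open>Here \<open>x\<close> is \<open>r\<close> or \<open>z \<otimes> r\<close> for a
  generator \<open>r\<close>, and the central sign disappears on squaring.\<close>

lemma noncentral_square:
  assumes "x \<in> carrier G" "\<not> \<one> \<approx> x"
  shows "x \<otimes> x = z"
proof -
  obtain r where r: "r \<in> {i, j, k}" "r \<approx> x"
    using noncentral_cases assms by metis
  then have "r \<in> carrier G" "r \<otimes> r = z"
    using ii jj kk by auto
  then show ?thesis
    using r(2) z_central[of r] m_assoc[of r z r] by (auto simp: upto_sign_def m_assoc zz)
qed

text \<open>This turns closure under inverses into closure under change of sign for the non-central
  letters.\<close>

lemma noncentral_inv:
  assumes "x \<in> carrier G" "\<not> \<one> \<approx> x"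
  shows "inv x = z \<otimes> x"
  using noncentral_square[OF assms] assms(1) by (intro inv_equality) (auto simp: m_assoc zz)

text \<open>In the Klein four-group three distinct non-zero elements have product 1; if two of the
  three coincide, they cancel and the remaining one is the product.\<close>

lemma triple_upto_sign:
  assumes "r \<in> {i, j, k}" "s \<in> {i, j, k}" "t \<in> {i, j, k}"
  shows "\<exists>y\<in>{\<one>, r, s, t}. r \<otimes> s \<otimes> t \<approx> y"
proof -
  have carr: "r \<in> carrier G" "s \<in> carrier G" "t \<in> carrier G"
    using assms by auto
  \<comment> \<open>The 27 cases are evaluated by two lookups in the table, with \<open>x\<close>
    the intermediate value of the first product.\<close>
  have "\<exists>x\<in>{\<one>, i, j, k}. r \<otimes> s \<approx> x \<and> (\<exists>y\<in>{\<one>, r, s, t}. x \<otimes> t \<approx> y)"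
    using assms by (elim insertE emptyE; simp add: klein_table upto_sign_refl)
  then obtain x y where xy: "r \<otimes> s \<approx> x" "y \<in> {\<one>, r, s, t}" "x \<otimes> t \<approx> y"
    by blast
  have "r \<otimes> s \<otimes> t \<approx> x \<otimes> t"
    using xy(1) carr by (intro upto_sign_mult upto_sign_refl) auto
  then show ?thesis
    using xy(2,3) carr upto_sign_trans by (meson m_closed)
qed

lemma triple_upto_sign_noncentral:
  assumes "a \<in> carrier G" "b \<in> carrier G" "c \<in> carrier G"
    and "\<not> \<one> \<approx> a" "\<not> \<one> \<approx> b" "\<not> \<one> \<approx> c"
  shows "\<exists>y\<in>{\<one>, a, b, c}. y \<approx> a \<otimes> b \<otimes> c"
proof -
  obtain r where r: "r \<in> {i, j, k}" "r \<approx> a" "a \<approx> r" using noncentral_cases assms by metis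
  obtain s where s: "s \<in> {i, j, k}" "s \<approx> b" "b \<approx> s" using noncentral_cases assms by metis
  obtain t where t: "t \<in> {i, j, k}" "t \<approx> c" "c \<approx> t" using noncentral_cases assms by metis
  have "a \<otimes> b \<otimes> c \<approx> r \<otimes> s \<otimes> t"
    using assms r s t by (intro upto_sign_mult) auto
  moreover obtain y where "y \<in> {\<one>, r, s, t}" "r \<otimes> s \<otimes> t \<approx> y"
    using triple_upto_sign r s t by metis
  moreover from \<open>y \<in> _\<close> obtain y' where "y' \<in> {\<one>, a, b, c}" "y \<approx> y'"
    using r s t upto_sign_refl by blast
  ultimately have "a \<otimes> b \<otimes> c \<approx> y'"
    using assms by (meson m_closed upto_sign_trans)
  then show ?thesis
    using \<open>y' \<in> _\<close> upto_sign_sym assms by (meson m_closed)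
qed

lemma short_word:
  assumes A: "A \<subseteq> carrier G" "\<And>a. a \<in> A \<Longrightarrow> inv a \<in> A"
    and abc: "a \<in> A" "b \<in> A" "c \<in> A"
  shows "\<exists>v\<in>lists A. length v \<le> 2 \<and> word_value G v = a \<otimes> b \<otimes> c"
proof -
  define short where "short x \<longleftrightarrow> (\<exists>v\<in>lists A. length v \<le> 2 \<and> word_value G v = x)" for x
  have short1: "short \<one>"
    unfolding short_def by (rule bexI[of _ "[]"]) auto
  have shortA: "short x" if "x \<in> A" for x
    unfolding short_def by (rule bexI[of _ "[x]"]) (use that A(1) in auto)
  have short2: "short (x \<otimes> y)" if "x \<in> A" "y \<in> A" for x y
    unfolding short_def by (rule bexI[of _ "[x, y]"]) (use that A(1) in auto)
  have neg: "z \<otimes> x \<in> A" if "x \<in> A" "\<not> \<one> \<approx> x" for x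
    using that A noncentral_inv by (metis subsetD)
  \<comment> \<open>A central letter in front can be absorbed: 1 is dropped, and \<open>z\<close>
    either changes the sign of a non-central \<open>y\<close>, forms a two-letter word with
    \<open>w\<close> when \<open>y\<close> is 1, or cancels against \<open>y\<close> when
    \<open>y\<close> is \<open>z\<close>.\<close>
  have central: "short (x \<otimes> (y \<otimes> w))" if xyw: "x \<in> A" "y \<in> A" "w \<in> A" and x: "\<one> \<approx> x" for x y w
  proof -
    have carr: "y \<in> carrier G" "w \<in> carrier G"
      using that A(1) by auto
    consider "x = \<one>" | "x = z" "\<not> \<one> \<approx> y" | "x = z" "y = \<one>" | "x = z" "y = z"
      using x by (auto simp: upto_sign_def)
    then show ?thesis
    proof cases
      case 2
      then show ?thesis
        using short2[OF neg[OF xyw(2)] xyw(3)] carr by (simp add: m_assoc)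
    qed (use short2 shortA xyw carr in auto)
  qed
  have carr: "a \<in> carrier G" "b \<in> carrier G" "c \<in> carrier G"
    using abc A(1) by auto
  \<comment> \<open>Used to move a central \<open>b\<close> or \<open>c\<close> to the front, so
    that \<open>central\<close> applies.\<close>
  have comm: "x \<otimes> y = y \<otimes> x" if "\<one> \<approx> x" "y \<in> carrier G" for x y
    using that z_central by (auto simp: upto_sign_def)
  consider "\<one> \<approx> a" | "\<one> \<approx> b" | "\<one> \<approx> c" | "\<not> \<one> \<approx> a" "\<not> \<one> \<approx> b" "\<not> \<one> \<approx> c"
    by blast
  then have "short (a \<otimes> b \<otimes> c)"
  proof cases
    case 1
    then show ?thesis
      using central[of a b c] abc carr by (simp add: m_assoc)
  next
    case 2
    then show ?thesis
      using central[of b a c] comm[of b a] abc carr by (metis m_assoc)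
  next
    case 3
    then show ?thesis
      using central[of c a b] comm[of c "a \<otimes> b"] abc carr by simp
  next
    case 4
    then obtain y where y: "y \<in> {\<one>, a, b, c}" "y \<approx> a \<otimes> b \<otimes> c"
      using triple_upto_sign_noncentral carr by blast
    \<comment> \<open>Both signs must be covered. For y = 1 the element \<open>z\<close> is spelled
      by the two letters a a; for a letter y, \<open>neg\<close> makes z y a letter as well.\<close>
    have "short y" "short (z \<otimes> y)"
      using y(1) short1 short2[of a a] shortA neg noncentral_square[of a] 4 abc carr by auto
    then show ?thesis
      using y(2) by (auto simp: upto_sign_def)
  qed
  then show ?thesis
    by (simp add: short_def)
qed

end

section \<open>From the presentation of \<open>Q8\<close> to the quaternion relations\<close>

lemma presented_group_generate:
  "generate (presented_group R) (range (\<lambda>x. pres_rel R `` {[(x, True)]})) =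
    carrier (presented_group R)" (is "generate ?G ?S = _")
proof
  interpret group ?G by (rule group_presented_group)
  have carr: "pres_rel R `` {u} \<in> carrier ?G" for u
    by (auto simp: presented_group_def quotient_def)
  show "generate ?G ?S \<subseteq> carrier ?G"
    using carr by (intro generate_incl) auto
  have one: "\<one>\<^bsub>?G\<^esub> = pres_rel R `` {[]}"
    by (simp add: presented_group_def)
  \<comment> \<open>Words also contain formal inverses, whose classes are the group inverses of the
    generators; concatenating letters then yields every class.\<close>
  have letter: "pres_rel R `` {[(x, b)]} \<in> generate ?G ?S" for x b
  proof (cases b)
    case True
    then show ?thesis by (auto intro: generate.incl)
  next
    case False
    have "pres_rel R `` {[(x, False), (x, True)]} = pres_rel R `` {[]}"
      using pres_cancel[of R x False] by (intro equiv_class_eq[OF equiv_pres_rel]) (simp add: pres_rel_def)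
    then have "inv\<^bsub>?G\<^esub> (pres_rel R `` {[(x, True)]}) = pres_rel R `` {[(x, False)]}"
      using carr by (intro inv_equality) (auto simp: presented_group_mult one)
    then show ?thesis
      using False generate.inv[of "pres_rel R `` {[(x, True)]}" ?S ?G] by simp
  qed
  have "pres_rel R `` {u} \<in> generate ?G ?S" for u
  proof (induction u)
    case Nil
    then show ?case by (metis one generate.one)
  next
    case (Cons a u)
    then show ?case
      using generate.eng[OF letter Cons.IH, of "fst a" "snd a"] by (simp add: presented_group_mult)
  qed
  then show "carrier ?G \<subseteq> generate ?G ?S"
    by (auto simp: presented_group_def quotient_def)
qed

lemma UNIV_q8_gen: "UNIV = {Gi, Gj, Gk}"
  using q8_gen.exhaust by auto

lemma quaternion_relations_Q8:
  "quaternion_relations Q8 (pres_rel q8_relators `` {[(Gi, True)]})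
    (pres_rel q8_relators `` {[(Gj, True)]}) (pres_rel q8_relators `` {[(Gk, True)]})"
proof -
  interpret group Q8 by (rule group_Q8)
  let ?c = "\<lambda>u. pres_rel q8_relators `` {u}"
  have mult: "?c u \<otimes>\<^bsub>Q8\<^esub> ?c v = ?c (u @ v)" for u v
    by (simp add: Q8_def presented_group_mult)
  have eq: "?c u = ?c v" if "pres_eq q8_relators u v" for u v
    using that by (intro equiv_class_eq[OF equiv_pres_rel]) (simp add: pres_rel_def)
  have carr: "?c u \<in> carrier Q8" for u
    by (auto simp: Q8_def presented_group_def quotient_def)
  have one: "\<one>\<^bsub>Q8\<^esub> = ?c []"
    by (simp add: Q8_def presented_group_def)
  \<comment> \<open>A relator x y w^-1 and the free cancellation w w^-1 both give 1, so w^-1 cancels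
    on the right and x y = w.\<close>
  have triple: "?c [(x, True)] \<otimes>\<^bsub>Q8\<^esub> ?c [(y, True)] = ?c [(w, True)]"
    if "[(x, True), (y, True), (w, False)] \<in> q8_relators" for x y w
  proof -
    have "?c [(x, True), (y, True)] \<otimes>\<^bsub>Q8\<^esub> ?c [(w, False)] = \<one>\<^bsub>Q8\<^esub>"
      using eq[OF pres_relator[OF that]] by (simp add: mult one)
    moreover have "?c [(w, True)] \<otimes>\<^bsub>Q8\<^esub> ?c [(w, False)] = \<one>\<^bsub>Q8\<^esub>"
      using eq[OF pres_cancel[of _ w True]] by (simp add: mult one)
    ultimately show ?thesis
      using carr by (metis right_cancel mult append_Cons append_Nil)
  qed
  show ?thesis
  proof
    have "range (\<lambda>x. ?c [(x, True)]) = {?c [(Gi, True)], ?c [(Gj, True)], ?c [(Gk, True)]}"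
      by (simp add: UNIV_q8_gen)
    then show "generate Q8 {?c [(Gi, True)], ?c [(Gj, True)], ?c [(Gk, True)]} = carrier Q8"
      using presented_group_generate[of q8_relators] by (simp add: Q8_def)
    have "pres_eq q8_relators [(Gi, True), (Gi, True), (Gi, True), (Gi, True)] []"
      by (rule pres_relator) (simp add: q8_relators_def)
    from eq[OF this] show "?c [(Gi, True)] \<otimes>\<^bsub>Q8\<^esub> ?c [(Gi, True)] \<otimes>\<^bsub>Q8\<^esub>
        (?c [(Gi, True)] \<otimes>\<^bsub>Q8\<^esub> ?c [(Gi, True)]) = \<one>\<^bsub>Q8\<^esub>"
      by (simp add: mult one)
  qed (rule carr | (rule triple, simp add: q8_relators_def))+
qed

theorem proposition3p4:
  fixes A :: "q8_gen gword set set"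
  assumes "finite A" and "symmetric_generating_set Q8 A"
  shows "piecewise_excluding A (Geo Q8 A)"
proof -
  interpret quaternion_relations Q8 "pres_rel q8_relators `` {[(Gi, True)]}"
    "pres_rel q8_relators `` {[(Gj, True)]}" "pres_rel q8_relators `` {[(Gk, True)]}"
    by (rule quaternion_relations_Q8)
  show ?thesis
    using assms short_word by (intro piecewise_excluding_Geo) (auto simp: symmetric_generating_set_def)
qed

end
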